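(* Let $\delta\in(0,1/2)$ and $n\in\mathbb{N}$, $n\ge1$. Let $(X,Y)$ be random variables with values in $\{0,1,\dots,n\}$ with joint distribution $$\Pr[X=i,Y=j]=\frac{(1-\delta)\delta_{ij}+\frac{\delta}{n}(1-\delta_{ij})}{n+1},$$ where $\delta_{ij}$ is the Kronecker delta. Let $\pi$ be a deterministic protocol in which Alice receives $X$, Bob receives $Y$, Bob outputs $\pi(X,Y)$, and $\Pr[\pi(X,Y)\ne X]\le\varepsilon$. Then the expected length of $\pi$ is at least $$\left(1-\delta-\frac{\delta}{n}\right)\log_2\!\left(\frac{\delta}{\varepsilon+\delta/n}\right)+(\delta-2\varepsilon)\log_2(n+1)-2\delta.$$
   Context: A deterministic protocol is a rooted binary tree in which each non-leaf vertex is owned by Alice or Bob; the owner sends a bit that is a function of his/her own input, and they follow the edge labelled by that bit (interaction in both directions is allowed); at the leaf reached, Bob outputs a value that is a function of the leaf and his input. The length on an input is the depth of the leaf reached; the expected length is its expectation over $(X,Y)$. *)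

theory Defs
  imports "HOL-Probability.Probability"
begin

text \<open>
  A protocol is a finite rooted binary tree. Each inner vertex carries the function by which its
  owner (Alice with input in \<open>'x\<close>, Bob with input in \<open>'y\<close>) computes the bit to send, followed by the
  subtree for bit 0 (\<open>False\<close>) and the subtree for bit 1 (\<open>True\<close>). Each leaf carries its own output
  function of Bob's input.
\<close>

datatype ('x, 'y, 'o) protocol =
    Leaf "'y \<Rightarrow> 'o"
  | Alice "'x \<Rightarrow> bool" "('x, 'y, 'o) protocol" "('x, 'y, 'o) protocol"
  | Bob "'y \<Rightarrow> bool" "('x, 'y, 'o) protocol" "('x, 'y, 'o) protocol"

primrec protocol_output :: "('x, 'y, 'o) protocol \<Rightarrow> 'x \<Rightarrow> 'y \<Rightarrow> 'o" where
  "protocol_output (Leaf out) x y = out y"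
| "protocol_output (Alice f p0 p1) x y =
     (if f x then protocol_output p1 x y else protocol_output p0 x y)"
| "protocol_output (Bob g p0 p1) x y =
     (if g y then protocol_output p1 x y else protocol_output p0 x y)"

text \<open>The depth of the leaf reached on input \<open>(x, y)\<close>.\<close>

primrec protocol_length :: "('x, 'y, 'o) protocol \<Rightarrow> 'x \<Rightarrow> 'y \<Rightarrow> nat" where
  "protocol_length (Leaf out) x y = 0"
| "protocol_length (Alice f p0 p1) x y =
     Suc (if f x then protocol_length p1 x y else protocol_length p0 x y)"
| "protocol_length (Bob g p0 p1) x y =
     Suc (if g y then protocol_length p1 x y else protocol_length p0 x y)"

definition kronecker_delta :: "nat \<Rightarrow> nat \<Rightarrow> real" where
  "kronecker_delta i j = (if i = j then 1 else 0)"

end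

theory Submission
  imports Defs
begin

text \<open>
  If \<open>T\<close> is a finite set of inputs and \<open>K\<close> is the number of ordered pairs from \<open>T\<close> reaching a common
  leaf, then the average length over \<open>T\<close> is at least the collision entropy \<open>log 2 (|T|\<^sup>2 / K)\<close> of the
  leaf. This is applied twice. On the diagonal, two inputs \<open>(i, i)\<close> and \<open>(j, j)\<close> at the same leaf
  force \<open>(i, j)\<close> to that leaf as well, where Bob cannot tell \<open>i\<close> from \<open>j\<close>; so a large \<open>K\<close> costs many
  errors. On the off-diagonal inputs with a correct output, a leaf contains at most one input for each
  value of \<open>Y\<close>, so \<open>K\<close> is at most \<open>(n + 1) |T|\<close>.
\<close>

subsection \<open>Logarithmic inequalities\<close>

text \<open>This is \<open>ln z \<le> z - 1\<close> at \<open>z = c * r / a\<close>. The ratio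
  \<open>r\<close> stays free, so that in a sum of such bounds it can be chosen to cancel the linear
  corrections.\<close>

lemma tangent_le_mult_log:
  fixes a c r :: real
  assumes "a \<ge> 0" "c \<ge> 0" "c = 0 \<Longrightarrow> a = 0" "r > 0"
  shows "a * log 2 r + (a - c * r) / ln 2 \<le> a * log 2 (a / c)"
proof (cases "a = 0")
  case True
  then show ?thesis using assms by simp
next
  case False
  then have pos: "a > 0" "c > 0" using assms by force+
  have "ln (c * r / a) \<le> c * r / a - 1"
    using pos assms by (intro ln_le_minus_one) auto
  then have "a * ln (c * r / a) \<le> c * r - a"
    using pos by (simp add: field_simps)
  moreover have "ln (c * r / a) = ln r - ln (a / c)"
    using pos assms by (simp add: ln_div ln_mult)
  ultimately have "a * ln r + (a - c * r) \<le> a * ln (a / c)"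
    by (simp add: algebra_simps)
  then have "(a * ln r + (a - c * r)) / ln 2 \<le> a * ln (a / c) / ln 2"
    by (intro divide_right_mono) auto
  then show ?thesis by (simp add: log_def add_divide_distrib)
qed

text \<open>Two tangent bounds are added with the common ratio \<open>r = (a + b) / (c + d)\<close>,
  for which the linear corrections sum to 0.\<close>

lemma log_sum_inequality:
  fixes a b c d :: real
  assumes "a \<ge> 0" "c \<ge> 0" "c = 0 \<Longrightarrow> a = 0" "b \<ge> 0" "d \<ge> 0" "d = 0 \<Longrightarrow> b = 0"
  shows "(a + b) * log 2 ((a + b) / (c + d)) \<le> a * log 2 (a / c) + b * log 2 (b / d)"
proof (cases "a + b = 0")
  case True
  then have "a = 0" "b = 0" using assms by auto
  then show ?thesis by simp
next
  case False
  then have pos: "a + b > 0" "c + d > 0"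
    using assms by (smt (verit))+
  define r where "r = (a + b) / (c + d)"
  have "r > 0" using pos by (simp add: r_def)
  have "(a + b) * log 2 r + ((a - c * r) / ln 2 + (b - d * r) / ln 2)
      \<le> a * log 2 (a / c) + b * log 2 (b / d)"
    using tangent_le_mult_log[of a c r] tangent_le_mult_log[of b d r] assms \<open>r > 0\<close>
    by (simp add: distrib_right)
  moreover have "(a - c * r) + (b - d * r) = 0"
    using pos by (simp add: r_def field_simps)
  then have "(a - c * r) / ln 2 + (b - d * r) / ln 2 = 0"
    by (metis add_divide_distrib div_0)
  ultimately show ?thesis by (simp add: r_def)
qed

text \<open>The inequality behind one inner vertex: \<open>a\<close> and \<open>b\<close> count the
  inputs sending each bit, \<open>c\<close> and \<open>d\<close> their collisions, and the extra
  \<open>a + b\<close> pays one bit per input. Write \<open>u * log 2 (u\<^sup>2 / v)\<close> as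
  \<open>u * log 2 u + u * log 2 (u / v)\<close>. The log sum inequality handles the second part as
  it stands, and the first part with both denominators equal to 1, where it says that one bit has
  entropy at most 1.\<close>

lemma collision_entropy_split:
  fixes a b c d :: real
  assumes "a \<ge> 0" "c \<ge> 0" "c = 0 \<Longrightarrow> a = 0" "b \<ge> 0" "d \<ge> 0" "d = 0 \<Longrightarrow> b = 0"
  shows "(a + b) * log 2 ((a + b)\<^sup>2 / (c + d))
      \<le> (a + b) + a * log 2 (a\<^sup>2 / c) + b * log 2 (b\<^sup>2 / d)"
proof -
  have sq: "u * log 2 (u\<^sup>2 / v) = u * log 2 u + u * log 2 (u / v)"
    if "u \<ge> 0" "v \<ge> 0" "v = 0 \<Longrightarrow> u = 0" for u v :: real
  proof (cases "u = 0")
    case False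
    then have "u > 0" "v > 0" using that by force+
    then show ?thesis
      by (simp add: log_divide log_mult power2_eq_square algebra_simps)
  qed simp
  have half: "u * log 2 (u / 2) = u * log 2 u - u" if "u \<ge> 0" for u :: real
    using that by (cases "u = 0") (auto simp: log_divide algebra_simps)
  have "(a + b) * log 2 ((a + b) / (c + d)) \<le> a * log 2 (a / c) + b * log 2 (b / d)"
    using assms by (rule log_sum_inequality)
  moreover have "(a + b) * log 2 ((a + b) / (1 + 1)) \<le> a * log 2 (a / 1) + b * log 2 (b / 1)"
    using assms by (intro log_sum_inequality) auto
  moreover have "(a + b) * log 2 ((a + b)\<^sup>2 / (c + d))
      = (a + b) * log 2 (a + b) + (a + b) * log 2 ((a + b) / (c + d))"
    using assms by (intro sq) auto
  ultimately show ?thesis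
    using sq[of a c] sq[of b d] half[of "a + b"] assms by auto
qed

subsection \<open>Transcripts and collisions\<close>

text \<open>Leaves carry no names, so the string of bits sent serves to identify the leaf
  reached.\<close>

primrec protocol_transcript :: "('x, 'y, 'o) protocol \<Rightarrow> 'x \<Rightarrow> 'y \<Rightarrow> bool list" where
  "protocol_transcript (Leaf out) x y = []"
| "protocol_transcript (Alice f p0 p1) x y =
     f x # (if f x then protocol_transcript p1 x y else protocol_transcript p0 x y)"
| "protocol_transcript (Bob g p0 p1) x y =
     g y # (if g y then protocol_transcript p1 x y else protocol_transcript p0 x y)"

text \<open>On \<open>(x, y')\<close> Alice's bits are determined by \<open>x\<close> and Bob's by
  \<open>y'\<close>; along the common path both agree with the shared transcript.\<close>

lemma transcript_rectangle:
  "protocol_transcript p x y = protocol_transcript p x' y' \<Longrightarrow>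
    protocol_transcript p x y' = protocol_transcript p x' y'"
  by (induction p) (auto split: if_splits)

lemma output_eq_of_transcript_eq:
  "protocol_transcript p x y = protocol_transcript p x' y \<Longrightarrow>
    protocol_output p x y = protocol_output p x' y"
  by (induction p) (auto split: if_splits)

text \<open>The pairs are ordered and include each input paired with itself. For finite nonempty
  \<open>T\<close> the cardinality divided by \<open>card T\<close> squared is the probability that
  two independent uniform elements of \<open>T\<close> reach the same leaf.\<close>

definition collisions ::
    "('x, 'y, 'o) protocol \<Rightarrow> ('x \<times> 'y) set \<Rightarrow> (('x \<times> 'y) \<times> ('x \<times> 'y)) set" where
  "collisions p T =
     {(s, t) \<in> T \<times> T. case_prod (protocol_transcript p) s = case_prod (protocol_transcript p) t}"

lemma finite_collisions: "finite T \<Longrightarrow> finite (collisions p T)"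
  by (rule finite_subset[of _ "T \<times> T"]) (auto simp: collisions_def)

lemma collisions_empty_iff: "collisions p T = {} \<longleftrightarrow> T = {}"
  by (auto simp: collisions_def)

lemma card_collisions_pos: "finite T \<Longrightarrow> T \<noteq> {} \<Longrightarrow> card (collisions p T) > 0"
  by (simp add: card_gt_0_iff finite_collisions collisions_empty_iff)

lemma collisions_eq_Sigma:
  "collisions p T = (SIGMA s:T. {t \<in> T. case_prod (protocol_transcript p) s
     = case_prod (protocol_transcript p) t})"
  by (auto simp: collisions_def)

lemma card_collisions_le_mult:
  assumes "finite T"
    and "\<And>s. s \<in> T \<Longrightarrow> card {t \<in> T. case_prod (protocol_transcript p) s
       = case_prod (protocol_transcript p) t} \<le> k"
  shows "card (collisions p T) \<le> card T * k"
proof -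
  have "card (collisions p T) = (\<Sum>s\<in>T. card {t \<in> T. case_prod (protocol_transcript p) s
      = case_prod (protocol_transcript p) t})"
    using assms(1) by (simp add: collisions_eq_Sigma)
  also have "\<dots> \<le> card T * k" using sum_bounded_above[of T _ k] assms(2) by simp
  finally show ?thesis .
qed

text \<open>The induction step shared by the vertices of Alice and Bob: \<open>b\<close> is the bit
  sent, \<open>q\<close> and \<open>r\<close> are the subtrees. Inputs sending different bits never
  collide, so the collision counts of the two halves add up.\<close>

lemma collision_bound_step:
  fixes L :: "'x \<times> 'y \<Rightarrow> nat"
  assumes "finite T"
    and IH0: "real (card {t \<in> T. \<not> b t})
        * log 2 ((real (card {t \<in> T. \<not> b t}))\<^sup>2 / real (card (collisions q {t \<in> T. \<not> b t})))
      \<le> (\<Sum>t | t \<in> T \<and> \<not> b t. real (Lq t))"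
    and IH1: "real (card {t \<in> T. b t})
        * log 2 ((real (card {t \<in> T. b t}))\<^sup>2 / real (card (collisions r {t \<in> T. b t})))
      \<le> (\<Sum>t | t \<in> T \<and> b t. real (Lr t))"
    and coll: "collisions p T = collisions q {t \<in> T. \<not> b t} \<union> collisions r {t \<in> T. b t}"
    and L: "\<And>t. t \<in> T \<Longrightarrow> L t = Suc (if b t then Lr t else Lq t)"
  shows "real (card T) * log 2 ((real (card T))\<^sup>2 / real (card (collisions p T)))
    \<le> (\<Sum>t\<in>T. real (L t))"
proof -
  let ?T0 = "{t \<in> T. \<not> b t}" and ?T1 = "{t \<in> T. b t}"
  have split: "T = ?T0 \<union> ?T1" "?T0 \<inter> ?T1 = {}" "finite ?T0" "finite ?T1"
    using assms(1) by auto
  have card: "card T = card ?T0 + card ?T1"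
    using split card_Un_disjoint by metis
  have "collisions q ?T0 \<inter> collisions r ?T1 = {}"
    by (auto simp: collisions_def)
  then have K: "card (collisions p T) = card (collisions q ?T0) + card (collisions r ?T1)"
    using coll split by (simp add: card_Un_disjoint finite_collisions)
  have "(\<Sum>t\<in>T. real (L t)) = (\<Sum>t\<in>?T0. real (L t)) + (\<Sum>t\<in>?T1. real (L t))"
    using sum.union_disjoint[OF split(3,4,2), of "\<lambda>t. real (L t)"]
    by (simp only: split(1)[symmetric])
  also have "(\<Sum>t\<in>?T0. real (L t)) = (\<Sum>t\<in>?T0. 1 + real (Lq t))"
    by (intro sum.cong) (auto simp: L)
  also have "(\<Sum>t\<in>?T1. real (L t)) = (\<Sum>t\<in>?T1. 1 + real (Lr t))"
    by (intro sum.cong) (auto simp: L)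
  finally have "(\<Sum>t\<in>T. real (L t)) = real (card ?T0) + real (card ?T1)
      + (\<Sum>t\<in>?T0. real (Lq t)) + (\<Sum>t\<in>?T1. real (Lr t))"
    by (simp add: sum.distrib)
  \<comment> \<open>A half without collisions is empty, because every input collides with itself;
    this supplies the zero side conditions of \<open>collision_entropy_split\<close>.\<close>
  moreover have "(real (card ?T0) + real (card ?T1)) * log 2 ((real (card ?T0) + real (card ?T1))\<^sup>2
        / (real (card (collisions q ?T0)) + real (card (collisions r ?T1))))
      \<le> (real (card ?T0) + real (card ?T1))
        + real (card ?T0) * log 2 ((real (card ?T0))\<^sup>2 / real (card (collisions q ?T0)))
        + real (card ?T1) * log 2 ((real (card ?T1))\<^sup>2 / real (card (collisions r ?T1)))"
    using card_collisions_pos[OF split(3), of q] card_collisions_pos[OF split(4), of r]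
    by (intro collision_entropy_split) fastforce+
  ultimately show ?thesis
    using IH0 IH1 card K by (simp only: of_nat_add)
qed

text \<open>Induction on the tree; at a leaf all pairs collide and both sides are 0. The set
  \<open>T\<close> is an arbitrary finite set of inputs, since the diagonal and the set of correct
  inputs need not be rectangles.\<close>

lemma collision_entropy_le_length:
  assumes "finite T"
  shows "real (card T) * log 2 ((real (card T))\<^sup>2 / real (card (collisions p T)))
    \<le> (\<Sum>t\<in>T. real (protocol_length p (fst t) (snd t)))"
  using assms
proof (induction p arbitrary: T)
  case (Leaf out)
  have "collisions (Leaf out) T = T \<times> T" by (auto simp: collisions_def)
  then show ?case
    by (simp add: card_cartesian_product power2_eq_square)
next
  case (Alice f p0 p1)
  let ?b = "\<lambda>t. f (fst t)"
  show ?case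
  proof (rule collision_bound_step[where b = ?b and q = p0 and r = p1])
    show "collisions (Alice f p0 p1) T
        = collisions p0 {t \<in> T. \<not> ?b t} \<union> collisions p1 {t \<in> T. ?b t}"
      by (auto simp: collisions_def split: if_splits)
  next
    fix t
    show "protocol_length (Alice f p0 p1) (fst t) (snd t)
        = Suc (if ?b t then protocol_length p1 (fst t) (snd t) else protocol_length p0 (fst t) (snd t))"
      by simp
  qed (use Alice in simp_all)
next
  case (Bob g p0 p1)
  let ?b = "\<lambda>t. g (snd t)"
  show ?case
  proof (rule collision_bound_step[where b = ?b and q = p0 and r = p1])
    show "collisions (Bob g p0 p1) T
        = collisions p0 {t \<in> T. \<not> ?b t} \<union> collisions p1 {t \<in> T. ?b t}"
      by (auto simp: collisions_def split: if_splits)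
  next
    fix t
    show "protocol_length (Bob g p0 p1) (fst t) (snd t)
        = Suc (if ?b t then protocol_length p1 (fst t) (snd t) else protocol_length p0 (fst t) (snd t))"
      by simp
  qed (use Bob in simp_all)
qed

subsection \<open>Collisions force errors\<close>

text \<open>Fix \<open>y\<close>. Every \<open>x\<close> with \<open>(x, x)\<close> at the leaf of
  \<open>(y, y)\<close> also has \<open>(x, y)\<close> there, so Bob gives the same answer on all
  these \<open>(x, y)\<close>. It is right for at most one \<open>x\<close>, and each of the others
  is an error.\<close>

lemma card_diagonal_collisions_le:
  fixes p :: "('a, 'a, 'a) protocol"
  assumes "finite A"
  shows "card (collisions p ((\<lambda>i. (i, i)) ` A))
    \<le> card A + card {(x, y) \<in> A \<times> A. protocol_output p x y \<noteq> x}"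
proof -
  let ?tr = "protocol_transcript p" and ?out = "protocol_output p"
  define C where "C y = {x \<in> A. ?tr x x = ?tr y y}" for y
  define W where "W y = {x \<in> A. ?out x y \<noteq> x}" for y
  have le: "card (C y) \<le> 1 + card (W y)" for y
  proof -
    have "C y \<subseteq> insert (?out y y) (W y)"
    proof
      fix x assume "x \<in> C y"
      then have "x \<in> A" "?tr x y = ?tr y y"
        using transcript_rectangle[of p x x y y] by (auto simp: C_def)
      then show "x \<in> insert (?out y y) (W y)"
        using output_eq_of_transcript_eq[of p x y y] by (auto simp: W_def)
    qed
    then have "card (C y) \<le> card (insert (?out y y) (W y))"
      using assms by (intro card_mono) (auto simp: W_def)
    also have "\<dots> \<le> 1 + card (W y)" using card_insert_le_m1[of "Suc (card (W y))" "W y"] by simp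
    finally show ?thesis .
  qed
  have "collisions p ((\<lambda>i. (i, i)) ` A) = (\<lambda>(y, x). ((y, y), (x, x))) ` (SIGMA y:A. C y)"
    by (auto simp: collisions_def C_def image_iff)
  then have "card (collisions p ((\<lambda>i. (i, i)) ` A)) = card (SIGMA y:A. C y)"
    by (simp add: card_image inj_on_def)
  also have "\<dots> = (\<Sum>y\<in>A. card (C y))"
    using assms by (simp add: C_def)
  also have "\<dots> \<le> (\<Sum>y\<in>A. 1 + card (W y))"
    by (intro sum_mono le)
  also have "\<dots> = card A + (\<Sum>y\<in>A. card (W y))"
    by (simp only: sum.distrib sum_constant) simp
  also have "(\<Sum>y\<in>A. card (W y)) = card (SIGMA y:A. W y)"
    using assms by (simp add: W_def)
  also have "card (SIGMA y:A. W y) = card (prod.swap ` (SIGMA y:A. W y))"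
    by (simp add: card_image)
  also have "prod.swap ` (SIGMA y:A. W y) = {(x, y) \<in> A \<times> A. ?out x y \<noteq> x}"
    by (auto simp: W_def image_iff)
  finally show ?thesis .
qed

text \<open>At a fixed leaf the output depends on \<open>y\<close> alone, and a correct output
  equals \<open>x\<close>. Hence \<open>snd\<close> is injective on the elements of \<open>S\<close>
  at one leaf.\<close>

lemma card_correct_collisions_le:
  assumes "finite B" "finite S" "snd ` S \<subseteq> B"
    and "\<And>x y. (x, y) \<in> S \<Longrightarrow> protocol_output p x y = x"
  shows "card (collisions p S) \<le> card S * card B"
proof (rule card_collisions_le_mult[OF assms(2)])
  fix s assume "s \<in> S"
  let ?C = "{t \<in> S. case_prod (protocol_transcript p) s = case_prod (protocol_transcript p) t}"
  have "inj_on snd ?C"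
  proof (rule inj_onI)
    fix t t' assume "t \<in> ?C" "t' \<in> ?C" "snd t = snd t'"
    then show "t = t'"
      using assms(4) output_eq_of_transcript_eq[of p "fst t" "snd t" "fst t'"]
      by (cases t; cases t') (auto simp: case_prod_unfold)
  qed
  then show "card ?C \<le> card B"
    using assms by (intro card_inj_on_le[of snd]) auto
qed

subsection \<open>Finitely valued pairs of random variables\<close>

lemma (in prob_space) expectation_finite_pair:
  fixes X Y :: "'a \<Rightarrow> nat" and f :: "nat \<Rightarrow> nat \<Rightarrow> real"
  assumes X: "X \<in> measurable M (count_space A)" and Y: "Y \<in> measurable M (count_space B)"
    and fin: "finite A" "finite B"
  shows "expectation (\<lambda>\<omega>. f (X \<omega>) (Y \<omega>))
    = (\<Sum>(i, j)\<in>A \<times> B. f i j * prob {\<omega> \<in> space M. X \<omega> = i \<and> Y \<omega> = j})"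
proof -
  let ?E = "\<lambda>i j. {\<omega> \<in> space M. X \<omega> = i \<and> Y \<omega> = j}"
  have ev: "?E i j \<in> events" if "i \<in> A" "j \<in> B" for i j
  proof -
    have "?E i j = (X -` {i} \<inter> space M) \<inter> (Y -` {j} \<inter> space M)" by auto
    then show ?thesis
      using that measurable_sets[OF X, of "{i}"] measurable_sets[OF Y, of "{j}"] by auto
  qed
  have "expectation (\<lambda>\<omega>. f (X \<omega>) (Y \<omega>))
      = expectation (\<lambda>\<omega>. \<Sum>t\<in>A \<times> B. f (fst t) (snd t) * indicator (?E (fst t) (snd t)) \<omega>)"
  proof (rule Bochner_Integration.integral_cong[OF refl])
    fix \<omega> assume \<omega>: "\<omega> \<in> space M"
    then have mem: "(X \<omega>, Y \<omega>) \<in> A \<times> B"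
      using measurable_space[OF X] measurable_space[OF Y] by auto
    have "(\<Sum>t\<in>A \<times> B. f (fst t) (snd t) * indicator (?E (fst t) (snd t)) \<omega>)
        = (\<Sum>t\<in>A \<times> B. if t = (X \<omega>, Y \<omega>) then f (fst t) (snd t) else 0)"
      using \<omega> by (intro sum.cong) (auto simp: indicator_def)
    also have "\<dots> = f (X \<omega>) (Y \<omega>)" using mem fin by (simp add: sum.delta')
    finally show "f (X \<omega>) (Y \<omega>)
        = (\<Sum>t\<in>A \<times> B. f (fst t) (snd t) * indicator (?E (fst t) (snd t)) \<omega>)" by simp
  qed
  also have "\<dots> = (\<Sum>t\<in>A \<times> B. f (fst t) (snd t) * prob (?E (fst t) (snd t)))"
    using ev by (subst Bochner_Integration.integral_sum)
      (auto simp: less_top[symmetric] intro!: sum.cong)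
  finally show ?thesis by (simp add: case_prod_unfold)
qed

lemma (in prob_space) prob_finite_pair:
  fixes X Y :: "'a \<Rightarrow> nat"
  assumes X: "X \<in> measurable M (count_space A)" and Y: "Y \<in> measurable M (count_space B)"
    and fin: "finite A" "finite B"
  shows "prob {\<omega> \<in> space M. P (X \<omega>) (Y \<omega>)}
    = (\<Sum>(i, j) | (i, j) \<in> A \<times> B \<and> P i j. prob {\<omega> \<in> space M. X \<omega> = i \<and> Y \<omega> = j})"
proof -
  have "prob {\<omega> \<in> space M. P (X \<omega>) (Y \<omega>)} = expectation (indicator {\<omega> \<in> space M. P (X \<omega>) (Y \<omega>)})"
    by (simp add: Int_def conj_commute)
  also have "\<dots> = expectation (\<lambda>\<omega>. of_bool (P (X \<omega>) (Y \<omega>)))"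
    by (intro Bochner_Integration.integral_cong) auto
  also have "\<dots> = (\<Sum>(i, j)\<in>A \<times> B. of_bool (P i j) * prob {\<omega> \<in> space M. X \<omega> = i \<and> Y \<omega> = j})"
    using X Y fin by (rule expectation_finite_pair)
  also have "\<dots> = (\<Sum>t\<in>A \<times> B. if P (fst t) (snd t)
      then prob {\<omega> \<in> space M. X \<omega> = fst t \<and> Y \<omega> = snd t} else 0)"
    by (intro sum.cong) auto
  also have "\<dots> = (\<Sum>t | t \<in> A \<times> B \<and> P (fst t) (snd t).
      prob {\<omega> \<in> space M. X \<omega> = fst t \<and> Y \<omega> = snd t})"
    using fin by (simp add: sum.If_cases Int_def)
  also have "\<dots> = (\<Sum>(i, j) | (i, j) \<in> A \<times> B \<and> P i j. prob {\<omega> \<in> space M. X \<omega> = i \<and> Y \<omega> = j})"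
    by (intro sum.cong) auto
  finally show ?thesis .
qed

subsection \<open>The lower bound\<close>

text \<open>Here \<open>u\<close> will be the fraction of off-diagonal inputs answered correctly.
  Replacing \<open>n\<close> by \<open>n + 1\<close> costs at most \<open>u\<close> and dropping
  \<open>u * log 2 u\<close> costs at most \<open>2 * (1 - u)\<close>, together
  \<open>2 - u\<close>. The 2 becomes the term \<open>2 * \<delta>\<close> of the final
  bound.\<close>

lemma correct_entropy_ge:
  fixes u :: real
  assumes "0 \<le> u" "u \<le> 1" "n \<ge> 1"
  shows "u * log 2 (u * real n) \<ge> u * log 2 (real n + 1) - 2"
proof (cases "u = 0")
  case False
  have n: "real n \<ge> 1" using assms by simp
  have "log 2 ((real n + 1) / 2) \<le> log 2 (real n)" using n by simp
  then have "log 2 (real n) \<ge> log 2 (real n + 1) - 1"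
    using n by (simp add: log_divide)
  then have le_n: "u * log 2 (real n) \<ge> u * (log 2 (real n + 1) - 1)"
    using assms by (intro mult_left_mono) auto
  \<comment> \<open>The tangent at 1 gives \<open>(u - 1) / ln 2\<close>; since \<open>u - 1\<close>
    is not positive, \<open>ln 2 \<ge> 1 / 2\<close> allows \<open>1 / ln 2\<close> to be replaced
    by 2.\<close>
  have le_u: "2 * (u - 1) \<le> u * log 2 u"
  proof -
    have "ln 2 \<ge> (1 / 2 :: real)"
      using ln_le_minus_one[of "1 / 2 :: real"] by (simp add: ln_div)
    then have "(1 - u) * 1 \<le> (1 - u) * (2 * ln 2)"
      using assms by (intro mult_left_mono) auto
    then have "2 * (u - 1) * ln 2 \<le> u - 1" by (simp add: algebra_simps)
    then have "2 * (u - 1) \<le> (u - 1) / ln 2" by (subst pos_le_divide_eq) auto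
    also have "\<dots> \<le> u * log 2 u"
      using tangent_le_mult_log[of u 1 1] assms by simp
    finally show ?thesis .
  qed
  have "u * log 2 (real n + 1) - 2 \<le> 2 * (u - 1) + u * (log 2 (real n + 1) - 1)"
    using assms by (simp add: algebra_simps)
  also have "\<dots> \<le> u * log 2 u + u * log 2 (real n)"
    using le_u le_n by (rule add_mono)
  also have "\<dots> = u * log 2 (u * real n)"
    using False n assms by (simp add: log_mult distrib_left)
  finally show ?thesis .
qed simp

theorem theorem6:
  fixes \<delta> \<epsilon> :: real and n :: nat
    and M :: "'a measure" and X Y :: "'a \<Rightarrow> nat"
    and \<pi> :: "(nat, nat, nat) protocol"
  assumes "0 < \<delta>" and "\<delta> < 1 / 2" and "n \<ge> 1"
    and "prob_space M"
    and "X \<in> measurable M (count_space {0..n})"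
    and "Y \<in> measurable M (count_space {0..n})"
    and "\<And>i j. i \<in> {0..n} \<Longrightarrow> j \<in> {0..n} \<Longrightarrow>
           measure M {\<omega> \<in> space M. X \<omega> = i \<and> Y \<omega> = j} =
             ((1 - \<delta>) * kronecker_delta i j + \<delta> / real n * (1 - kronecker_delta i j))
               / (real n + 1)"
    and "measure M {\<omega> \<in> space M. protocol_output \<pi> (X \<omega>) (Y \<omega>) \<noteq> X \<omega>} \<le> \<epsilon>"
  shows "prob_space.expectation M (\<lambda>\<omega>. real (protocol_length \<pi> (X \<omega>) (Y \<omega>))) \<ge>
           (1 - \<delta> - \<delta> / real n) * log 2 (\<delta> / (\<epsilon> + \<delta> / real n))
             + (\<delta> - 2 * \<epsilon>) * log 2 (real n + 1) - 2 * \<delta>"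
proof -
  interpret prob_space M by fact
  define A where "A = {0..n}"
  define N where "N = real n + 1"
  \<comment> \<open>The probability of each single off-diagonal input.\<close>
  define w where "w = \<delta> / (real n * N)"
  define D where "D = (\<lambda>i. (i, i)) ` A"
  define F where "F = A \<times> A - D"
  define E where "E = {(x, y) \<in> A \<times> A. protocol_output \<pi> x y \<noteq> x}"
  define S where "S = F - E"
  let ?len = "\<lambda>x y. real (protocol_length \<pi> x y)"
  let ?p = "\<lambda>i j. prob {\<omega> \<in> space M. X \<omega> = i \<and> Y \<omega> = j}"
  have n: "real n \<ge> 1" using assms(3) by simp
  have N: "N > 1" using n by (simp add: N_def)
  have w: "w > 0" using n N assms(1) by (simp add: w_def)
  have finA: "finite A" "card A = Suc n" by (simp_all add: A_def)
  have D: "finite D" "D \<subseteq> A \<times> A" "card D = Suc n"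
    using finA by (auto simp: D_def card_image inj_on_def)
  have F: "finite F" "F \<subseteq> A \<times> A" "D \<inter> F = {}" "A \<times> A = D \<union> F"
    using finA D by (auto simp: F_def)
  have "card (A \<times> A) = card D + card F"
    unfolding F(4) using D(1) F(1,3) by (rule card_Un_disjoint)
  then have "card F = n * Suc n"
    using finA D by (simp add: card_cartesian_product)
  then have cardF: "real (card F) = real n * N"
    by (simp add: N_def field_simps)
  have E_sub: "E \<subseteq> A \<times> A" by (auto simp: E_def)
  then have E: "finite E" using finA finite_subset by blast
  have S: "finite S" "S \<subseteq> F" using F by (auto simp: S_def)

  have pD: "?p i j = (1 - \<delta>) / N" if "(i, j) \<in> D" for i j
    using that assms(7)[of i j] by (auto simp: D_def A_def kronecker_delta_def N_def)
  have pF: "?p i j = w" if "(i, j) \<in> F" for i j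
    using that assms(7)[of i j]
    by (auto simp: F_def D_def A_def kronecker_delta_def N_def w_def)
  \<comment> \<open>Off-diagonal inputs are the lightest, as
    \<open>\<delta> / n \<le> \<delta> \<le> 1 - \<delta>\<close>. So every error, on or off the
    diagonal, costs at least \<open>w\<close>, and at most \<open>\<epsilon> / w\<close> inputs are
    errors.\<close>
  have "w \<le> (1 - \<delta>) / N"
  proof -
    have "\<delta> / real n \<le> \<delta>" using n assms(1) by (simp add: divide_le_eq)
    then have "\<delta> / real n / N \<le> (1 - \<delta>) / N"
      using assms(2) N by (intro divide_right_mono) auto
    then show ?thesis by (simp add: w_def)
  qed
  then have pE: "w \<le> ?p i j" if "(i, j) \<in> E" for i j
    using that E_sub F(4) pD pF by (metis UnE order_refl subsetD)

  have "prob {\<omega> \<in> space M. protocol_output \<pi> (X \<omega>) (Y \<omega>) \<noteq> X \<omega>} = (\<Sum>(i, j)\<in>E. ?p i j)"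
    using prob_finite_pair[of X "{0..n}" Y "{0..n}" "\<lambda>x y. protocol_output \<pi> x y \<noteq> x"] assms(5,6)
    by (simp add: E_def A_def case_prod_unfold)
  moreover have "(\<Sum>t\<in>E. w) \<le> (\<Sum>(i, j)\<in>E. ?p i j)"
    using pE by (intro sum_mono) auto
  ultimately have err: "real (card E) * w \<le> \<epsilon>"
    using assms(8) by simp
  then have eps: "\<epsilon> \<ge> 0" using w by (meson mult_nonneg_nonneg of_nat_0_le_iff less_imp_le order_trans)

  have "expectation (\<lambda>\<omega>. ?len (X \<omega>) (Y \<omega>)) = (\<Sum>(i, j)\<in>A \<times> A. ?len i j * ?p i j)"
    using expectation_finite_pair[of X "{0..n}" Y "{0..n}"] assms(5,6) by (simp add: A_def)
  also have "\<dots> = (\<Sum>(i, j)\<in>D. ?len i j * ?p i j) + (\<Sum>(i, j)\<in>F. ?len i j * ?p i j)"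
    unfolding F(4) using D(1) F(1,3) by (rule sum.union_disjoint)
  also have "(\<Sum>(i, j)\<in>D. ?len i j * ?p i j) = (1 - \<delta>) / N * (\<Sum>(i, j)\<in>D. ?len i j)"
    unfolding sum_distrib_left using pD by (intro sum.cong) auto
  also have "(\<Sum>(i, j)\<in>F. ?len i j * ?p i j) = w * (\<Sum>(i, j)\<in>F. ?len i j)"
    unfolding sum_distrib_left using pF by (intro sum.cong) auto
  finally have expect: "expectation (\<lambda>\<omega>. ?len (X \<omega>) (Y \<omega>))
      = (1 - \<delta>) / N * (\<Sum>(i, j)\<in>D. ?len i j) + w * (\<Sum>(i, j)\<in>F. ?len i j)" .

  have diag: "(1 - \<delta> - \<delta> / real n) * log 2 (\<delta> / (\<epsilon> + \<delta> / real n))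
      \<le> (1 - \<delta>) / N * (\<Sum>(i, j)\<in>D. ?len i j)" (is "_ * ?l \<le> ?d")
  proof -
    define K where "K = real (card (collisions \<pi> D))"
    have "D \<noteq> {}" using D(3) by auto
    then have K: "K > 0" using card_collisions_pos D(1) by (simp add: K_def)
    have "card (collisions \<pi> D) \<le> card A + card E"
      unfolding D_def E_def using finA(1) by (rule card_diagonal_collisions_le)
    then have "K \<le> N + real (card E)" using finA by (simp add: K_def N_def)
    also have "real (card E) \<le> \<epsilon> / w" using err w by (simp add: le_divide_eq)
    finally have "K \<le> N + \<epsilon> / w" by simp
    also have "\<dots> = N * real n / \<delta> * (\<epsilon> + \<delta> / real n)"
      using n N assms(1) by (simp add: w_def field_simps)
    finally have KN: "K \<le> N * real n / \<delta> * (\<epsilon> + \<delta> / real n)" .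
    have pos: "\<epsilon> + \<delta> / real n > 0" using eps assms(1) n by (intro add_nonneg_pos) auto
    have "\<delta> * K \<le> N * real n * (\<epsilon> + \<delta> / real n)"
      using KN assms(1) by (simp add: field_simps)
    \<comment> \<open>Relaxing \<open>real n\<close> to \<open>N\<close> turns the estimate into a
      lower bound for \<open>N\<^sup>2 / K\<close>, the quantity in the collision entropy of the
      diagonal.\<close>
    also have "\<dots> \<le> N * N * (\<epsilon> + \<delta> / real n)"
      using pos N by (intro mult_right_mono mult_left_mono) (auto simp: N_def)
    finally have "\<delta> / (\<epsilon> + \<delta> / real n) \<le> N\<^sup>2 / K"
      using pos K by (simp add: power2_eq_square divide_le_eq le_divide_eq mult_ac)
    then have "?l \<le> log 2 (N\<^sup>2 / K)"
      using pos assms(1) K N by (subst log_le_cancel_iff) auto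
    then have "N * ?l \<le> N * log 2 (N\<^sup>2 / K)" using N by simp
    also have "\<dots> \<le> (\<Sum>(i, j)\<in>D. ?len i j)"
      using collision_entropy_le_length[OF D(1), of \<pi>] D(3)
      by (simp add: case_prod_unfold K_def N_def add.commute)
    finally have "(1 - \<delta>) / N * (N * ?l) \<le> ?d"
      using assms(2) N by (intro mult_left_mono) auto
    then have "(1 - \<delta>) * ?l \<le> ?d" using N by simp
    moreover have "0 \<le> ?d"
      using assms(2) N by (intro mult_nonneg_nonneg sum_nonneg) auto
    moreover have "\<delta> / real n \<le> \<delta>" using n assms(1) by (simp add: divide_le_eq)
    then have "0 \<le> 1 - \<delta> - \<delta> / real n" "1 - \<delta> - \<delta> / real n \<le> 1 - \<delta>"
      using assms(1,2) n by auto
    \<comment> \<open>If \<open>?l \<ge> 0\<close>, lowering the factor \<open>1 - \<delta>\<close>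
      to \<open>1 - \<delta> - \<delta> / real n\<close> keeps the bound. If \<open>?l\<close> is
      negative, the left side is at most 0, while the length term is at least 0.\<close>
    ultimately show ?thesis
      by (cases "?l \<ge> 0")
        (meson mult_right_mono order_trans, meson linear mult_nonneg_nonpos order_trans)
  qed

  have off: "(\<delta> - 2 * \<epsilon>) * log 2 N - 2 * \<delta> \<le> w * (\<Sum>(i, j)\<in>F. ?len i j)"
  proof -
    define s where "s = real (card S)"
    \<comment> \<open>The fraction of off-diagonal inputs on which the output is correct.\<close>
    define u where "u = s / (real n * N)"
    have nN: "real n * N > 0" using n N by simp
    have s: "0 \<le> s" "s \<le> real n * N"
      using cardF card_mono[OF F(1) S(2)] by (simp_all add: s_def flip: cardF)
    then have u: "0 \<le> u" "u \<le> 1" using nN by (simp_all add: u_def)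
    have "w * (real n * N) = \<delta>" "w * s = \<delta> * u" "s / N = u * real n"
      using n N by (simp_all add: w_def u_def)
    have "card F \<le> card S + card E"
      using card_mono[of "S \<union> E" F] card_Un_le[of S E] S(1) E by (force simp: S_def)
    then have "real n * N \<le> s + real (card E)" by (simp add: s_def flip: cardF)
    then have "w * (real n * N) \<le> w * s + \<epsilon>"
      using mult_left_mono[of "real n * N" "s + real (card E)" w] w err by (simp add: algebra_simps)
    then have \<delta>u: "\<delta> \<le> \<delta> * u + \<epsilon>"
      using \<open>w * (real n * N) = \<delta>\<close> \<open>w * s = \<delta> * u\<close> by simp
    have "snd ` S \<subseteq> A" using S(2) F(2) by auto
    moreover have "protocol_output \<pi> x y = x" if "(x, y) \<in> S" for x y
      using that F(2) by (auto simp: S_def E_def)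
    ultimately have "card (collisions \<pi> S) \<le> card S * card A"
      by (rule card_correct_collisions_le[OF finA(1) S(1)])
    then have "real (card (collisions \<pi> S)) \<le> real (card S * card A)"
      by (simp only: of_nat_le_iff)
    then have K: "real (card (collisions \<pi> S)) \<le> s * N"
      using finA by (simp add: s_def N_def algebra_simps)
    \<comment> \<open>The bound \<open>s * N\<close> on the collisions gives collision entropy at
      least \<open>log 2 (s / N)\<close>, where \<open>s / N = u * real n\<close>. For empty
      \<open>S\<close> both sides are 0.\<close>
    have "s * log 2 (s / N) \<le> s * log 2 (s\<^sup>2 / real (card (collisions \<pi> S)))"
    proof (cases "S = {}")
      case False
      then have pos: "s > 0" "real (card (collisions \<pi> S)) > 0"
        using S(1) card_collisions_pos[of S \<pi>] by (auto simp: s_def card_gt_0_iff)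
      have "s / N \<le> s\<^sup>2 / real (card (collisions \<pi> S))"
        using pos N K mult_left_mono[OF K, of s]
        by (simp add: divide_le_eq le_divide_eq power2_eq_square mult_ac)
      then show ?thesis using pos N by (intro mult_left_mono) auto
    qed (simp add: s_def)
    also have "\<dots> \<le> (\<Sum>(i, j)\<in>S. ?len i j)"
      using collision_entropy_le_length[OF S(1)] by (simp add: case_prod_unfold s_def)
    also have "\<dots> \<le> (\<Sum>(i, j)\<in>F. ?len i j)"
      using F(1) S(2) by (intro sum_mono2) auto
    finally have "w * (s * log 2 (s / N)) \<le> w * (\<Sum>(i, j)\<in>F. ?len i j)"
      using w by (intro mult_left_mono) auto
    moreover have "w * (s * log 2 (s / N)) = \<delta> * (u * log 2 (u * real n))"
      using \<open>w * s = \<delta> * u\<close> \<open>s / N = u * real n\<close> by (metis mult.assoc)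
    moreover have "\<delta> * (u * log 2 N - 2) \<le> \<delta> * (u * log 2 (u * real n))"
      using correct_entropy_ge[OF u assms(3)] assms(1) by (intro mult_left_mono) (auto simp: N_def)
    \<comment> \<open>The chain is \<open>\<delta> * u \<ge> \<delta> - \<epsilon> \<ge> \<delta> -
      2 * \<epsilon>\<close>, with \<open>log 2 N\<close> positive.\<close>
    moreover have "(\<delta> - 2 * \<epsilon>) * log 2 N \<le> (\<delta> * u) * log 2 N"
      using \<delta>u eps N by (intro mult_right_mono) auto
    ultimately show ?thesis by (simp add: algebra_simps)
  qed

  show ?thesis
    using diag off expect by (simp add: N_def)
qed

end
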